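(* Consider a causal model on a causal structure $\mathcal G$, and let $X,Y,Z$ be pairwise disjoint sets of observed nodes with $X,Y$ non-empty. If the affects relation $X\vDash Y\mid\mathrm{do}(Z)$ holds and satisfies both Irred$_1$ and Irred$_3$, then for every $e\in X\cup Z$ there exists $e_Y\in Y$ such that $e$ is a cause of $e_Y$, i.e. there is a directed path from $e$ to $e_Y$ in $\mathcal G$.
   Context: **Causal model.** A causal structure is a directed graph $\mathcal G$ (cycles allowed) whose nodes are observed or unobserved; the finitely many observed nodes are random variables. For sets of nodes, $AB:=A\cup B$. A path between two nodes (ignoring edge directions) is blocked by a set $C$ if it contains a chain $A\to V\to B$ or fork $A\leftarrow V\to B$ with $V\in C$, or a collider $A\to V\leftarrow B$ with neither $V$ nor any descendant of $V$ in $C$. For disjoint $A,B,C$, $(A\perp^dB\mid C)_{\mathcal G}$ means every path from an element of $A$ to an element of $B$ is blocked by $C$. A distribution $P$ over the observed nodes has the d-separation property relative to $\mathcal G$ if $(A\perp^dB|C)_{\mathcal G}$ implies $P(AB|C)=P(A|C)P(B|C)$ for all disjoint sets $A,B,C$ of observed nodes. For a set $X$ of observed nodes, $\mathcal G_{\mathrm{do}(X)}$ is $\mathcal G$ with all edges into nodes of $X$ removed ($\mathcal G_{\mathrm{do}(\emptyset)}=\mathcal G$). A causal model consists of $\mathcal G$, and for every set $X$ of observed nodes a distribution $P_{\mathcal G_{\mathrm{do}(X)}}$ of the observed nodes with the d-separation property relative to $\mathcal G_{\mathrm{do}(X)}$, such that if $X$ consists of nodes exogenous in $\mathcal G$ and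 is disjoint from $Y$, then $P_{\mathcal G_{\mathrm{do}(Y)}}(R|XY)=P_{\mathcal G_{\mathrm{do}(XY)}}(R|XY)$ for $R$ the remaining observed nodes. Conditional distributions given values of intervened nodes are taken as specified for all such values. Standing fact of the framework (third rule of do-calculus): for disjoint sets of observed nodes, $P_{\mathcal G_{\mathrm{do}(XZ)}}(Y|XZ)=P_{\mathcal G_{\mathrm{do}(X)}}(Y|X)$ whenever $(Y\perp^dZ\mid X)_{\mathcal G_{\mathrm{do}(XZ)}}$. **Affects relations.** For pairwise disjoint $X,Y,Z$ with $X,Y$ non-empty, $X\vDash Y\mid\mathrm{do}(Z)$ holds iff there are values $x,z$ with $P_{\mathcal G_{\mathrm{do}(XZ)}}(Y|X=x,Z=z)\ne P_{\mathcal G_{\mathrm{do}(Z)}}(Y|Z=z)$; $\not\vDash$ is the negation. **Irreducibility** of $X\vDash Y\mid\mathrm{do}(Z)$: - It is Red$_1$ if there is a non-empty $s_X\subsetneq X$ with $s_X\not\vDash Y\mid\mathrm{do}((X\setminus s_X)Z)$; Irred$_1$ means not Red$_1$. - It is Red$_3$ if there is a non-empty $s_Z\subseteq Z$ such that, with $\tilde s_Z=Z\setminus s_Z$, both $s_Z\not\vDash Y\mid\mathrm{do}(X\tilde s_Z)$ and $s_Z\not\vDash Y\mid\mathrm{do}(\tilde s_Z)$; Irred$_3$ means not Red$_3$. *)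

theory Defs
  imports "HOL-Probability.Probability" "Graph_Theory.Graph_Theory"
begin

section \<open>Interventions and d-separation in directed graphs\<close>

definition do_graph :: "'v pair_pre_digraph \<Rightarrow> 'v set \<Rightarrow> 'v pair_pre_digraph" where
  "do_graph G X = G\<lparr>parcs := {e \<in> parcs G. snd e \<notin> X}\<rparr>"

definition exogenous :: "'v pair_pre_digraph \<Rightarrow> 'v \<Rightarrow> bool" where
  "exogenous G v \<longleftrightarrow> in_arcs G v = {}"

definition is_cause :: "'v pair_pre_digraph \<Rightarrow> 'v \<Rightarrow> 'v \<Rightarrow> bool" where
  "is_cause G u v \<longleftrightarrow> u \<rightarrow>\<^sup>+\<^bsub>G\<^esub> v"

text \<open>A path ignoring edge directions is given by its distinct nodes \<open>vs\<close> together with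
  the arcs \<open>es\<close> it uses. The arcs have to be recorded since \<open>G\<close> may contain both \<open>(u,v)\<close> and
  \<open>(v,u)\<close>, in which case \<open>vs\<close> does not determine which nodes are colliders.\<close>

definition undirected_path :: "'v pair_pre_digraph \<Rightarrow> 'v list \<Rightarrow> ('v \<times> 'v) list \<Rightarrow> bool" where
  "undirected_path G vs es \<longleftrightarrow>
     distinct vs \<and> set vs \<subseteq> pverts G \<and> length vs = Suc (length es) \<and>
     (\<forall>i<length es. es ! i \<in> parcs G \<and>
        (es ! i = (vs ! i, vs ! Suc i) \<or> es ! i = (vs ! Suc i, vs ! i)))"

definition chain_at :: "('v \<times> 'v) \<Rightarrow> 'v \<Rightarrow> ('v \<times> 'v) \<Rightarrow> bool" where
  "chain_at e v f \<longleftrightarrow> (snd e = v \<and> fst f = v) \<or> (fst e = v \<and> snd f = v)"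

definition fork_at :: "('v \<times> 'v) \<Rightarrow> 'v \<Rightarrow> ('v \<times> 'v) \<Rightarrow> bool" where
  "fork_at e v f \<longleftrightarrow> fst e = v \<and> fst f = v"

definition collider_at :: "('v \<times> 'v) \<Rightarrow> 'v \<Rightarrow> ('v \<times> 'v) \<Rightarrow> bool" where
  "collider_at e v f \<longleftrightarrow> snd e = v \<and> snd f = v"

text \<open>Reachability is reflexive on nodes, so the collider case covers the collider itself.\<close>

definition blocked ::
  "'v pair_pre_digraph \<Rightarrow> 'v set \<Rightarrow> 'v list \<Rightarrow> ('v \<times> 'v) list \<Rightarrow> bool" where
  "blocked G C vs es \<longleftrightarrow>
     (\<exists>i. Suc i < length es \<and>
        (let e = es ! i; v = vs ! Suc i; f = es ! Suc i in
           ((chain_at e v f \<or> fork_at e v f) \<and> v \<in> C) \<or>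
           (collider_at e v f \<and> (\<forall>w. v \<rightarrow>\<^sup>*\<^bsub>G\<^esub> w \<longrightarrow> w \<notin> C))))"

definition d_separated ::
  "'v pair_pre_digraph \<Rightarrow> 'v set \<Rightarrow> 'v set \<Rightarrow> 'v set \<Rightarrow> bool" where
  "d_separated G A B C \<longleftrightarrow>
     (\<forall>vs es. undirected_path G vs es \<and> hd vs \<in> A \<and> last vs \<in> B \<longrightarrow> blocked G C vs es)"

definition pairwise_disjoint3 :: "'v set \<Rightarrow> 'v set \<Rightarrow> 'v set \<Rightarrow> bool" where
  "pairwise_disjoint3 A B C \<longleftrightarrow> A \<inter> B = {} \<and> A \<inter> C = {} \<and> B \<inter> C = {}"


section \<open>Conditional independence and conditional distributions\<close>

text \<open>The random variable at node \<open>v\<close> takes values in an arbitrary measurable space \<open>S v\<close>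
  (only the \<open>\<sigma>\<close>-algebra of \<open>S v\<close> is used); discrete variables are the case of countable
  \<open>count_space\<close>s. Joint values of the nodes in \<open>U\<close> are the points of \<open>Pi\<^sub>M U S\<close>.\<close>

definition sigma_of :: "('v \<Rightarrow> 'a measure) \<Rightarrow> ('v \<Rightarrow> 'a) measure \<Rightarrow> 'v set \<Rightarrow> ('v \<Rightarrow> 'a) measure" where
  "sigma_of S M C = vimage_algebra (space M) (\<lambda>\<omega>. restrict \<omega> C) (Pi\<^sub>M C S)"

definition event_of ::
  "('v \<Rightarrow> 'a) measure \<Rightarrow> 'v set \<Rightarrow> ('v \<Rightarrow> 'a) set \<Rightarrow> ('v \<Rightarrow> 'a) set" where
  "event_of M A a = {\<omega> \<in> space M. restrict \<omega> A \<in> a}"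

text \<open>\<open>P(AB|C) = P(A|C) P(B|C)\<close>, with \<open>P(\<cdot>|C)\<close> the conditional probability given the
  \<open>\<sigma>\<close>-algebra generated by the variables in \<open>C\<close>.\<close>

definition cond_indep ::
  "('v \<Rightarrow> 'a measure) \<Rightarrow> ('v \<Rightarrow> 'a) measure \<Rightarrow> 'v set \<Rightarrow> 'v set \<Rightarrow> 'v set \<Rightarrow> bool" where
  "cond_indep S M A B C \<longleftrightarrow>
     (\<forall>a \<in> sets (Pi\<^sub>M A S). \<forall>b \<in> sets (Pi\<^sub>M B S). AE \<omega> in M.
        real_cond_exp M (sigma_of S M C) (indicator (event_of M A a \<inter> event_of M B b)) \<omega> =
        real_cond_exp M (sigma_of S M C) (indicator (event_of M A a)) \<omega> *
        real_cond_exp M (sigma_of S M C) (indicator (event_of M B b)) \<omega>)"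

definition d_sep_property ::
  "'v pair_pre_digraph \<Rightarrow> 'v set \<Rightarrow> ('v \<Rightarrow> 'a measure) \<Rightarrow> ('v \<Rightarrow> 'a) measure \<Rightarrow> bool" where
  "d_sep_property G Obs S M \<longleftrightarrow>
     (\<forall>A B C. A \<subseteq> Obs \<and> B \<subseteq> Obs \<and> C \<subseteq> Obs \<and> pairwise_disjoint3 A B C \<and> d_separated G A B C
        \<longrightarrow> cond_indep S M A B C)"

text \<open>For a distribution \<open>M\<close> of the nodes in \<open>I\<close>, the kernel \<open>\<kappa>\<close> is a (regular) conditional
  distribution of the nodes in \<open>I - X\<close> given those in \<open>X\<close>. If \<open>X = x\<close> has positive probability
  and singletons are measurable, this means \<open>\<kappa> x = M(I - X | X = x)\<close>.\<close>

definition is_cond_distr ::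
  "('v \<Rightarrow> 'a measure) \<Rightarrow> 'v set \<Rightarrow> ('v \<Rightarrow> 'a) measure \<Rightarrow> 'v set \<Rightarrow>
   (('v \<Rightarrow> 'a) \<Rightarrow> ('v \<Rightarrow> 'a) measure) \<Rightarrow> bool" where
  "is_cond_distr S I M X \<kappa> \<longleftrightarrow>
     M = distr M (Pi\<^sub>M X S) (\<lambda>\<omega>. restrict \<omega> X) \<bind>
           (\<lambda>x. distr (\<kappa> x) (Pi\<^sub>M I S) (\<lambda>r. merge X (I - X) (x, r)))"


section \<open>Causal models\<close>

text \<open>\<open>P X\<close> is the distribution of all observed nodes after intervening on \<open>X\<close>, and
  \<open>K X x\<close> is the distribution of the nodes in \<open>Obs - X\<close> conditional on \<open>X = x\<close> after
  intervening on \<open>X\<close>. The kernel is part of the data, because it has to be specified for every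
  value \<open>x\<close>, including those outside the support of \<open>P X\<close>.

  The last axiom is \<open>P\<^bsub>do(Y)\<^esub>(R|XY) = P\<^bsub>do(XY)\<^esub>(R|XY)\<close>. Under \<open>do(Y)\<close> the nodes
  in \<open>X\<close> are not intervened on, so the left-hand side is an ordinary conditional of \<open>K Y y\<close>,
  determined up to null sets only.\<close>

locale causal_model = pair_wf_digraph G
  for G :: "'v pair_pre_digraph" +
  fixes Obs :: "'v set"
    and S :: "'v \<Rightarrow> 'a measure"
    and P :: "'v set \<Rightarrow> ('v \<Rightarrow> 'a) measure"
    and K :: "'v set \<Rightarrow> ('v \<Rightarrow> 'a) \<Rightarrow> ('v \<Rightarrow> 'a) measure"
  assumes observed_nodes: "Obs \<subseteq> pverts G" "finite Obs"
    and joint_distr: "X \<subseteq> Obs \<Longrightarrow> P X \<in> space (prob_algebra (Pi\<^sub>M Obs S))"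
    and kernel: "X \<subseteq> Obs \<Longrightarrow> K X \<in> Pi\<^sub>M X S \<rightarrow>\<^sub>M prob_algebra (Pi\<^sub>M (Obs - X) S)"
    and kernel_cond: "X \<subseteq> Obs \<Longrightarrow> is_cond_distr S Obs (P X) X (K X)"
    and d_sep: "X \<subseteq> Obs \<Longrightarrow> d_sep_property (do_graph G X) Obs S (P X)"
    and exogenous_do:
      "\<lbrakk>X \<subseteq> Obs; Y \<subseteq> Obs; X \<inter> Y = {}; \<forall>v\<in>X. exogenous G v; y \<in> space (Pi\<^sub>M Y S)\<rbrakk> \<Longrightarrow>
         is_cond_distr S (Obs - Y) (K Y y) X (\<lambda>x. K (X \<union> Y) (merge X Y (x, y)))"

text \<open>\<open>P\<^bsub>do(W)\<^esub>(Y | W = w)\<close>\<close>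

definition do_cond ::
  "('v \<Rightarrow> 'a measure) \<Rightarrow> ('v set \<Rightarrow> ('v \<Rightarrow> 'a) \<Rightarrow> ('v \<Rightarrow> 'a) measure) \<Rightarrow>
   'v set \<Rightarrow> ('v \<Rightarrow> 'a) \<Rightarrow> 'v set \<Rightarrow> ('v \<Rightarrow> 'a) measure" where
  "do_cond S K W w Y = distr (K W w) (Pi\<^sub>M Y S) (\<lambda>r. restrict r Y)"

definition do_calculus_rule3 ::
  "'v pair_pre_digraph \<Rightarrow> 'v set \<Rightarrow> ('v \<Rightarrow> 'a measure) \<Rightarrow>
   ('v set \<Rightarrow> ('v \<Rightarrow> 'a) \<Rightarrow> ('v \<Rightarrow> 'a) measure) \<Rightarrow> bool" where
  "do_calculus_rule3 G Obs S K \<longleftrightarrow>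
     (\<forall>X Y Z. X \<subseteq> Obs \<and> Y \<subseteq> Obs \<and> Z \<subseteq> Obs \<and> pairwise_disjoint3 X Y Z \<and>
        d_separated (do_graph G (X \<union> Z)) Y Z X \<longrightarrow>
        (\<forall>x \<in> space (Pi\<^sub>M X S). \<forall>z \<in> space (Pi\<^sub>M Z S).
           do_cond S K (X \<union> Z) (merge X Z (x, z)) Y = do_cond S K X x Y))"


section \<open>Affects relations\<close>

text \<open>\<open>X \<Turnstile> Y | do(Z)\<close>. The side conditions (\<open>X\<close>, \<open>Y\<close>, \<open>Z\<close> pairwise disjoint sets of observed
  nodes, \<open>X\<close> and \<open>Y\<close> non-empty) are left to the context, so that the negation does not hold
  merely because one of them fails.\<close>

definition affects ::
  "('v \<Rightarrow> 'a measure) \<Rightarrow> ('v set \<Rightarrow> ('v \<Rightarrow> 'a) \<Rightarrow> ('v \<Rightarrow> 'a) measure) \<Rightarrow>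
   'v set \<Rightarrow> 'v set \<Rightarrow> 'v set \<Rightarrow> bool" where
  "affects S K X Y Z \<longleftrightarrow>
     (\<exists>x \<in> space (Pi\<^sub>M X S). \<exists>z \<in> space (Pi\<^sub>M Z S).
        do_cond S K (X \<union> Z) (merge X Z (x, z)) Y \<noteq> do_cond S K Z z Y)"

definition Red1 ::
  "('v \<Rightarrow> 'a measure) \<Rightarrow> ('v set \<Rightarrow> ('v \<Rightarrow> 'a) \<Rightarrow> ('v \<Rightarrow> 'a) measure) \<Rightarrow>
   'v set \<Rightarrow> 'v set \<Rightarrow> 'v set \<Rightarrow> bool" where
  "Red1 S K X Y Z \<longleftrightarrow>
     (\<exists>s. s \<noteq> {} \<and> s \<subset> X \<and> \<not> affects S K s Y ((X - s) \<union> Z))"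

definition Red3 ::
  "('v \<Rightarrow> 'a measure) \<Rightarrow> ('v set \<Rightarrow> ('v \<Rightarrow> 'a) \<Rightarrow> ('v \<Rightarrow> 'a) measure) \<Rightarrow>
   'v set \<Rightarrow> 'v set \<Rightarrow> 'v set \<Rightarrow> bool" where
  "Red3 S K X Y Z \<longleftrightarrow>
     (\<exists>s. s \<noteq> {} \<and> s \<subseteq> Z \<and>
        \<not> affects S K s Y (X \<union> (Z - s)) \<and> \<not> affects S K s Y (Z - s))"

abbreviation Irred1 ::
  "('v \<Rightarrow> 'a measure) \<Rightarrow> ('v set \<Rightarrow> ('v \<Rightarrow> 'a) \<Rightarrow> ('v \<Rightarrow> 'a) measure) \<Rightarrow>
   'v set \<Rightarrow> 'v set \<Rightarrow> 'v set \<Rightarrow> bool" where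
  "Irred1 S K X Y Z \<equiv> \<not> Red1 S K X Y Z"

abbreviation Irred3 ::
  "('v \<Rightarrow> 'a measure) \<Rightarrow> ('v set \<Rightarrow> ('v \<Rightarrow> 'a) \<Rightarrow> ('v \<Rightarrow> 'a) measure) \<Rightarrow>
   'v set \<Rightarrow> 'v set \<Rightarrow> 'v set \<Rightarrow> bool" where
  "Irred3 S K X Y Z \<equiv> \<not> Red3 S K X Y Z"

end

theory Submission
  imports Defs
begin

text \<open>If \<open>e\<close> causes no element of \<open>Y\<close>, then \<open>Y\<close> and \<open>e\<close> are d-separated by \<open>W\<close> after
  intervening on \<open>W \<union> {e}\<close>: a path from \<open>Y\<close> to \<open>e\<close> leaves \<open>e\<close> by an outgoing arc and is
  not directed all the way, so it has a collider, and a collider has no descendants in \<open>W\<close> because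
  nodes of \<open>W\<close> have no incoming arcs. By the third rule of do-calculus, \<open>e\<close> then does not affect
  \<open>Y\<close> given any \<open>do(W)\<close>, and the singleton \<open>{e}\<close> witnesses reducibility (or contradicts the
  affects relation itself if \<open>X = {e}\<close>).\<close>

lemma arcs_ends_with_proj: "arcs_ends (with_proj G) = parcs G"
  by (auto simp: arcs_ends_def arc_to_ends_def)

lemma parcs_do_graph: "e \<in> parcs (do_graph G X) \<longleftrightarrow> e \<in> parcs G \<and> snd e \<notin> X"
  by (simp add: do_graph_def)

text \<open>A nontrivial walk into \<open>w\<close> would end with an arc into \<open>X\<close>, and
  \<open>do_graph\<close> deletes those.\<close>

lemma do_graph_reachable_intervened:
  assumes "v \<rightarrow>\<^sup>*\<^bsub>with_proj (do_graph G X)\<^esub> w" and "w \<in> X"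
  shows "v = w"
proof -
  have "(v, w) \<in> (parcs (do_graph G X))\<^sup>*"
    using reachable_rtranclI[OF assms(1)] by (simp only: arcs_ends_with_proj)
  then show ?thesis
    using assms(2) by (cases rule: rtranclE) (auto simp: parcs_do_graph)
qed

lemma d_separated_of_not_cause:
  assumes "\<forall>y\<in>Y. \<not> is_cause G e y" and "e \<notin> Y" and "e \<in> X" and "W \<subseteq> X"
  shows "d_separated (do_graph G X) Y {e} W"
  unfolding d_separated_def
proof (intro allI impI)
  fix vs es
  assume A: "undirected_path (do_graph G X) vs es \<and> hd vs \<in> Y \<and> last vs \<in> {e}"
  define n where "n = length es"
  have len: "length vs = Suc n" and arcs: "\<And>i. i < n \<Longrightarrow> es ! i \<in> parcs (do_graph G X)"
    and ends: "\<And>i. i < n \<Longrightarrow> es ! i = (vs ! i, vs ! Suc i) \<or> es ! i = (vs ! Suc i, vs ! i)"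
    using A by (auto simp: undirected_path_def n_def)
  have first: "vs ! 0 \<in> Y" and last: "vs ! n = e"
    using A len by (cases vs; auto simp: last_conv_nth)+
  have "n > 0"
    using first last assms(2) by (cases n) auto
  \<comment> \<open>Otherwise the path read backwards is a directed path from \<open>e\<close> to
    \<open>vs ! 0\<close>, which lies in \<open>Y\<close>.\<close>
  have "\<exists>i<n. es ! i \<noteq> (vs ! Suc i, vs ! i)"
  proof (rule ccontr)
    assume "\<not> ?thesis"
    then have arc: "(vs ! Suc i, vs ! i) \<in> parcs G" if "i < n" for i
      using arcs[OF that] that by (auto simp: parcs_do_graph)
    have "(vs ! n, vs ! 0) \<in> (parcs G)\<^sup>+"
      using \<open>n > 0\<close>
    proof (induction rule: strict_inc_induct)
      case (base i)
      then show ?case using arc[of i] by auto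
    next
      case (step i)
      with arc[of i] show ?case by (meson Suc_lessD trancl.trancl_into_trancl)
    qed
    then show False
      using assms(1) first last by (auto simp: is_cause_def arcs_ends_with_proj)
  qed
  \<comment> \<open>Take the last arc pointing towards \<open>e\<close>. The next arc points back,
    so the two collide at \<open>vs ! Suc i\<close>.\<close>
  then obtain i where i: "i < n" "es ! i \<noteq> (vs ! Suc i, vs ! i)"
    and later: "\<And>j. j < n \<Longrightarrow> es ! j \<noteq> (vs ! Suc j, vs ! j) \<Longrightarrow> j \<le> i"
    using ex_has_greatest_nat[of "\<lambda>i. i < n \<and> es ! i \<noteq> (vs ! Suc i, vs ! i)" _ "\<lambda>i. i" n]
    by simp blast
  have fwd: "es ! i = (vs ! i, vs ! Suc i)" and notX: "vs ! Suc i \<notin> X"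
    using ends[OF i(1)] arcs[OF i(1)] i(2) by (auto simp: parcs_do_graph)
  \<comment> \<open>The next arc exists: arc \<open>i\<close> survives the intervention, so its head
    is outside \<open>X\<close> and cannot be \<open>e\<close>.\<close>
  have "Suc i < n"
    using i(1) notX last assms(3) by (metis Suc_lessI)
  moreover have "es ! Suc i = (vs ! Suc (Suc i), vs ! Suc i)"
    using later[of "Suc i"] calculation by auto
  moreover have "w \<notin> W" if "vs ! Suc i \<rightarrow>\<^sup>*\<^bsub>with_proj (do_graph G X)\<^esub> w" for w
    using do_graph_reachable_intervened[OF that] notX assms(4) by auto
  ultimately show "blocked (do_graph G X) W vs es"
    unfolding blocked_def Let_def collider_at_def using fwd
    by (intro exI[of _ i]) (auto simp: n_def)
qed

lemma not_affects_of_not_cause: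
  assumes "do_calculus_rule3 G Obs S K"
    and "e \<in> Obs" and "Y \<subseteq> Obs" and "W \<subseteq> Obs"
    and "e \<notin> Y" and "e \<notin> W" and "W \<inter> Y = {}"
    and "\<forall>y\<in>Y. \<not> is_cause G e y"
  shows "\<not> affects S K {e} Y W"
proof -
  have "d_separated (do_graph G (W \<union> {e})) Y {e} W"
    by (rule d_separated_of_not_cause) (use assms in auto)
  then have "do_cond S K (W \<union> {e}) (merge W {e} (w, x)) Y = do_cond S K W w Y"
    if "x \<in> space (Pi\<^sub>M {e} S)" "w \<in> space (Pi\<^sub>M W S)" for x w
    by (intro assms(1)[unfolded do_calculus_rule3_def, rule_format])
      (use assms that in \<open>auto simp: pairwise_disjoint3_def\<close>)
  \<comment> \<open>The third rule lists the values of \<open>W\<close> first,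
    \<open>affects\<close> those of \<open>{e}\<close>.\<close>
  moreover have "merge {e} W (x, w) = merge W {e} (w, x)" for x w
    using assms(6) by (intro merge_commute) auto
  ultimately show ?thesis
    unfolding affects_def Un_commute[of "{e}"] by metis
qed

theorem corollary4p15:
  fixes G :: "'v pair_pre_digraph"
    and Obs :: "'v set"
    and S :: "'v \<Rightarrow> 'a measure"
    and P :: "'v set \<Rightarrow> ('v \<Rightarrow> 'a) measure"
    and K :: "'v set \<Rightarrow> ('v \<Rightarrow> 'a) \<Rightarrow> ('v \<Rightarrow> 'a) measure"
    and X Y Z :: "'v set"
  assumes "causal_model G Obs S P K"
    and "do_calculus_rule3 G Obs S K"
    and "X \<subseteq> Obs" and "Y \<subseteq> Obs" and "Z \<subseteq> Obs"
    and "pairwise_disjoint3 X Y Z"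
    and "X \<noteq> {}" and "Y \<noteq> {}"
    and "affects S K X Y Z"
    and "Irred1 S K X Y Z"
    and "Irred3 S K X Y Z"
  shows "\<forall>e \<in> X \<union> Z. \<exists>e\<^sub>Y \<in> Y. is_cause G e e\<^sub>Y"
proof (rule ccontr)
  have disj: "X \<inter> Y = {}" "X \<inter> Z = {}" "Y \<inter> Z = {}"
    using assms(6) by (auto simp: pairwise_disjoint3_def)
  assume "\<not> (\<forall>e \<in> X \<union> Z. \<exists>e\<^sub>Y \<in> Y. is_cause G e e\<^sub>Y)"
  then obtain e where e: "e \<in> X \<union> Z" and not_cause: "\<forall>y\<in>Y. \<not> is_cause G e y"
    by auto
  \<comment> \<open>\<open>W\<close> stays arbitrary because \<open>Red3\<close> needs two different
    conditioning sets.\<close>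
  have not_affects: "\<not> affects S K {e} Y W" if "W \<subseteq> X \<union> Z - {e}" for W
    by (rule not_affects_of_not_cause[OF assms(2)])
      (use that e not_cause assms(3-5) disj in auto)
  show False
  proof (cases "e \<in> X")
    case True
    have "\<not> affects S K {e} Y ((X - {e}) \<union> Z)"
      using True disj by (intro not_affects) auto
    then show False
      \<comment> \<open>\<open>Red1\<close> requires a proper subset of \<open>X\<close>. For
        \<open>X = {e}\<close> the conditioning set is just \<open>Z\<close>, which contradicts the
        affects relation.\<close>
      using True assms(9,10) by (cases "X = {e}") (auto simp: Red1_def)
  next
    case False
    have "\<not> affects S K {e} Y (X \<union> (Z - {e}))" "\<not> affects S K {e} Y (Z - {e})"
      using False by (auto intro!: not_affects)
    then show False
      using False e assms(11) unfolding Red3_def by blast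
  qed
qed

end
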